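(* Let $H$ be a real or complex Hilbert space, $A:H\to H$ be a continuous linear operator, $\lambda_1,\dots,\lambda_n$ be pairwise distinct scalars, and $m_1,\dots,m_n$ be natural numbers. Then the system of subspaces $H_k:=\ker\left((A-\lambda_kI)^{m_k}\right)$, $k=1,\dots,n$, possesses the IBAP.
   Context: A system of closed subspaces $H_1,\dots,H_n$ of $H$, with $P_k$ the orthogonal projection onto $H_k$, possesses the inverse best approximation property (IBAP) if for arbitrary $x_1\in H_1,\dots,x_n\in H_n$ there exists $x\in H$ such that $P_kx=x_k$ for all $k=1,\dots,n$. $I$ is the identity operator; scalars are elements of the base field of $H$; natural numbers are $1,2,3,\dots$. *)

theory Defs
  imports "HOL-Analysis.Analysis"
begin

text \<open>
  Real Hilbert spaces are types of sort \<open>{real_inner, complete_space}\<close>. The classes below are the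
  complex counterpart: the real scalar multiplication is the restriction of the complex one, and
  the norm is the one induced by the complex inner product. The inner product is linear in
  its first argument.
\<close>

class complex_vector = real_vector +
  fixes scaleC :: "complex \<Rightarrow> 'a \<Rightarrow> 'a"  (infixr \<open>*\<^sub>C\<close> 75)
  assumes scaleC_add_right: "a *\<^sub>C (x + y) = a *\<^sub>C x + a *\<^sub>C y"
    and scaleC_add_left: "(a + b) *\<^sub>C x = a *\<^sub>C x + b *\<^sub>C x"
    and scaleC_scaleC: "a *\<^sub>C (b *\<^sub>C x) = (a * b) *\<^sub>C x"
    and scaleC_one: "1 *\<^sub>C x = x"
    and scaleR_scaleC: "r *\<^sub>R x = complex_of_real r *\<^sub>C x"

class complex_inner = complex_vector + real_normed_vector +
  fixes cinner :: "'a \<Rightarrow> 'a \<Rightarrow> complex"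
  assumes cinner_commute: "cinner x y = cnj (cinner y x)"
    and cinner_add_left: "cinner (x + y) z = cinner x z + cinner y z"
    and cinner_scaleC_left: "cinner (a *\<^sub>C x) y = a * cinner x y"
    and cinner_ge_zero: "0 \<le> Re (cinner x x)"
    and cinner_eq_zero_iff: "cinner x x = 0 \<longleftrightarrow> x = 0"
    and norm_eq_sqrt_cinner: "norm x = sqrt (Re (cinner x x))"

class complex_hilbert = complex_inner + complete_space

instantiation complex :: complex_hilbert
begin

definition scaleC_complex :: "complex \<Rightarrow> complex \<Rightarrow> complex"
  where "scaleC_complex a x = a * x"

definition cinner_complex :: "complex \<Rightarrow> complex \<Rightarrow> complex"
  where "cinner_complex x y = x * cnj y"

instance
  by standard
    (auto simp: scaleC_complex_def cinner_complex_def algebra_simps scaleR_conv_of_real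
      cmod_def power2_eq_square)

end

lemma vector_space_scaleC: "vector_space (scaleC :: complex \<Rightarrow> 'a::complex_vector \<Rightarrow> 'a)"
  by standard (simp_all add: scaleC_add_right scaleC_add_left scaleC_scaleC scaleC_one)

text \<open>
  The definitions below take the inner product \<open>ip\<close> (\<open>inner\<close> or \<open>cinner\<close>) and the
  scalar multiplication \<open>scl\<close> (\<open>scaleR\<close> or \<open>scaleC\<close>) as parameters, so as to serve both base fields.
\<close>

text \<open>
  The orthogonal projection of \<open>x\<close> onto \<open>M\<close>. The description is meaningful when \<open>M\<close> is a closed
  subspace of a Hilbert space: then such a \<open>y\<close> exists and is unique.
\<close>

definition orth_proj ::
    "('a::ab_group_add \<Rightarrow> 'a \<Rightarrow> 'k::zero) \<Rightarrow> 'a set \<Rightarrow> 'a \<Rightarrow> 'a"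
  where "orth_proj ip M x = (THE y. y \<in> M \<and> (\<forall>z\<in>M. ip (x - y) z = 0))"

text \<open>
  The inverse best approximation property of a system \<open>H 1, \<dots>, H n\<close> of closed subspaces.
\<close>

definition ibap ::
    "('a::ab_group_add \<Rightarrow> 'a \<Rightarrow> 'k::zero) \<Rightarrow> nat \<Rightarrow> (nat \<Rightarrow> 'a set) \<Rightarrow> bool"
  where "ibap ip n H \<longleftrightarrow>
    (\<forall>x. (\<forall>k\<in>{1..n}. x k \<in> H k) \<longrightarrow> (\<exists>z. \<forall>k\<in>{1..n}. orth_proj ip (H k) z = x k))"

definition ker_power ::
    "('k \<Rightarrow> 'a::ab_group_add \<Rightarrow> 'a) \<Rightarrow> ('a \<Rightarrow> 'a) \<Rightarrow> 'k \<Rightarrow> nat \<Rightarrow> 'a set"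
  where "ker_power scl A l m = {x. ((\<lambda>y. A y - scl l y) ^^ m) x = 0}"

end

theory Submission
  imports Defs
begin

text \<open>
  Suppose that for each \<open>j\<close> there is a bounded operator \<open>E j\<close> that is the identity on \<open>H j\<close> and
  vanishes on the other \<open>H i\<close>. Then \<open>z = (\<Sum>j. (E j)\<^sup>* (x j))\<close> solves the interpolation problem: for
  \<open>h \<in> H k\<close> one gets \<open>\<langle>z, h\<rangle> = (\<Sum>j. \<langle>x j, E j h\<rangle>) = \<langle>x k, h\<rangle>\<close>, which says that \<open>x k\<close> is the projection
  of \<open>z\<close> onto \<open>H k\<close>. The vector \<open>z\<close> is the Riesz representative of the bounded functional
  \<open>h \<mapsto> (\<Sum>j. \<langle>x j, E j h\<rangle>)\<close>; it is found by minimising \<open>\<parallel>x\<parallel>\<^sup>2 - 2 \<phi> x\<close> (\<open>riesz_representation\<close>,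
  \<open>ibap_if_separating\<close>).

  For the kernels \<open>H k = ker (A - \<lambda>\<^sub>k)\<^sup>m\<^sup>k\<close> such operators are polynomials in \<open>A\<close>. For two distinct
  scalars \<open>\<lambda>\<close>, \<open>\<mu>\<close> with exponents \<open>p\<close>, \<open>q\<close>, put \<open>T = (A - \<mu>) / (\<lambda> - \<mu>)\<close>. Then \<open>T\<close> is the identity plus a
  multiple of \<open>A - \<lambda>\<close>, so \<open>1 - T\<^sup>q\<close> is divisible by \<open>A - \<lambda>\<close>, and \<open>1 - (1 - T\<^sup>q)\<^sup>p\<close> is the identity
  on \<open>ker (A - \<lambda>)\<^sup>p\<close> and zero on \<open>ker (A - \<mu>)\<^sup>q\<close> (\<open>separate_two_kernels\<close>). The product of
  these operators over all \<open>\<mu> \<noteq> \<lambda>\<close> is the required \<open>E\<close> (\<open>separate_kernels\<close>).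

  Both base fields are treated together: on a complex Hilbert space the real part of the inner
  product is a real inner product with the same norm, and it has the same orthogonal projections
  onto complex subspaces (\<open>orth_proj_Re_cinner\<close>).
\<close>

section \<open>Interpolation by separating operators\<close>

text \<open>
  A real inner product that induces the given norm. This is a locale and not the class
  \<open>real_inner\<close> because it must also cover the real part of a complex inner product.
\<close>

locale real_form =
  fixes ip :: "'a::{real_normed_vector, complete_space} \<Rightarrow> 'a \<Rightarrow> real"
  assumes ip_sym: "ip x y = ip y x"
    and ip_add_left: "ip (x + y) z = ip x z + ip y z"
    and ip_scaleR_left: "ip (r *\<^sub>R x) y = r * ip x y"
    and ip_self: "ip x x = (norm x)\<^sup>2"
begin

lemma ip_add_right: "ip z (x + y) = ip z x + ip z y"
  by (metis ip_sym ip_add_left)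

lemma ip_scaleR_right: "ip y (r *\<^sub>R x) = r * ip y x"
  by (metis ip_sym ip_scaleR_left)

lemma ip_diff_left: "ip (x - y) z = ip x z - ip y z"
  using ip_add_left[of "x - y" y z] by simp

lemma norm_add_scaleR_sq:
  "(norm (x + r *\<^sub>R y))\<^sup>2 = (norm x)\<^sup>2 + 2 * r * ip x y + r\<^sup>2 * (norm y)\<^sup>2"
  unfolding ip_self[symmetric]
  by (simp add: ip_add_left ip_add_right ip_scaleR_left ip_scaleR_right ip_sym[of y x]
      power2_eq_square algebra_simps)

lemma parallelogram:
  fixes x y :: 'a
  shows "(norm (x + y))\<^sup>2 + (norm (x - y))\<^sup>2 = 2 * (norm x)\<^sup>2 + 2 * (norm y)\<^sup>2"
  using norm_add_scaleR_sq[of x 1 y] norm_add_scaleR_sq[of x "-1" y] by simp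

text \<open>Polarisation reduces the Cauchy-Schwarz bound to the triangle inequality.\<close>

lemma ip_le_norm: "\<bar>ip x y\<bar> \<le> norm x * norm y"
proof -
  have upper: "ip u y \<le> norm u * norm y" for u
  proof -
    have "(norm (u + y))\<^sup>2 \<le> (norm u + norm y)\<^sup>2"
      by (intro power_mono norm_triangle_ineq) auto
    then show ?thesis
      using norm_add_scaleR_sq[of u 1 y] by (simp add: power2_sum)
  qed
  show ?thesis
    using upper[of x] upper[of "-x"] ip_scaleR_left[of "-1" x y] by simp
qed

lemma bounded_linear_ip: "bounded_linear (ip x)"
  by (rule bounded_linear_intro[where K = "norm x"])
    (use ip_le_norm[of x] in \<open>simp_all add: ip_add_right ip_scaleR_right mult.commute[of "norm x"]\<close>)

text \<open>
  The functional \<open>J x = \<parallel>x\<parallel>\<^sup>2 - 2 \<phi> x\<close> is bounded below. By the parallelogram law two points at which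
  it is close to its infimum are close to each other, so a minimising sequence converges, and the
  vanishing of the derivative of \<open>J\<close> at the minimum is the claim.
\<close>

lemma riesz_representation:
  assumes "bounded_linear \<phi>"
  obtains z where "\<And>h. ip z h = \<phi> h"
proof -
  interpret \<phi>: bounded_linear \<phi> by fact
  obtain K where K: "\<And>x. \<bar>\<phi> x\<bar> \<le> norm x * K"
    using \<phi>.bounded by auto
  define J where "J x = (norm x)\<^sup>2 - 2 * \<phi> x" for x
  define d where "d = Inf (range J)"
  have "- K\<^sup>2 \<le> J x" for x
  proof -
    have "0 \<le> (norm x - K)\<^sup>2" by simp
    then show ?thesis
      using K[of x] unfolding J_def power2_diff by linarith
  qed
  then have bdd: "bdd_below (range J)"
    by (intro bdd_belowI[where m = "- K\<^sup>2"]) auto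
  have d_le: "d \<le> J x" for x
    unfolding d_def using bdd by (auto intro: cInf_lower)
  have "\<exists>x. J x < d + inverse (real (Suc k))" for k
  proof -
    have "Inf (range J) < d + inverse (real (Suc k))"
      by (simp add: d_def)
    then show ?thesis
      using bdd by (subst (asm) cInf_less_iff) auto
  qed
  then obtain X where X: "\<And>k. J (X k) < d + inverse (real (Suc k))"
    by metis
  have dist_le: "(norm (x - y))\<^sup>2 \<le> 2 * (J x - d) + 2 * (J y - d)" for x y
  proof -
    define w where "w = (1/2) *\<^sub>R (x + y)"
    have "4 * (norm w)\<^sup>2 = (norm (x + y))\<^sup>2" and "2 * \<phi> w = \<phi> x + \<phi> y"
      by (simp_all add: w_def power_divide \<phi>.scaleR \<phi>.add)
    then have "(norm (x - y))\<^sup>2 = 2 * J x + 2 * J y - 4 * J w"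
      using parallelogram[of x y] by (simp add: J_def algebra_simps)
    then show ?thesis
      using d_le[of w] by simp
  qed
  have "Cauchy X"
  proof (rule metric_CauchyI)
    fix e :: real assume "0 < e"
    then obtain N where N: "inverse (real (Suc N)) < e\<^sup>2 / 4"
      using reals_Archimedean[of "e\<^sup>2 / 4"] by auto
    have small: "J (X i) - d < e\<^sup>2 / 4" if "N \<le> i" for i
    proof -
      have "inverse (real (Suc i)) \<le> inverse (real (Suc N))"
        using that by (intro le_imp_inverse_le) auto
      then show ?thesis
        using X[of i] N by linarith
    qed
    have "dist (X i) (X j) < e" if "N \<le> i" "N \<le> j" for i j
    proof -
      have "(norm (X i - X j))\<^sup>2 < e\<^sup>2"
        using dist_le[of "X i" "X j"] small[OF that(1)] small[OF that(2)] by argo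
      then show ?thesis
        using \<open>0 < e\<close> by (simp add: dist_norm power2_less_imp_less)
    qed
    then show "\<exists>M. \<forall>i\<ge>M. \<forall>j\<ge>M. dist (X i) (X j) < e"
      by blast
  qed
  then obtain z where z: "X \<longlonglongrightarrow> z"
    using Cauchy_convergent_iff convergent_def by blast
  have "(\<lambda>k. J (X k)) \<longlonglongrightarrow> J z"
    unfolding J_def by (intro tendsto_intros z \<phi>.tendsto)
  moreover have "(\<lambda>k. d + inverse (real (Suc k))) \<longlonglongrightarrow> d"
    using LIMSEQ_inverse_real_of_nat_add .
  ultimately have Jz: "J z \<le> d"
    by (rule LIMSEQ_le) (use X less_imp_le in blast)
  have "ip z h = \<phi> h" for h
  proof -
    define a where "a = ip z h - \<phi> h"
    define b where "b = (norm h)\<^sup>2 + 1"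
    have "0 < b"
      by (simp add: b_def add_nonneg_pos)
    have *: "0 \<le> 2 * t * a + t\<^sup>2 * (norm h)\<^sup>2" for t
      using d_le[of "z + t *\<^sub>R h"] Jz
      unfolding J_def a_def norm_add_scaleR_sq \<phi>.add \<phi>.scaleR
      by (simp add: algebra_simps)
    \<comment> \<open>The step \<open>- a / b\<close> nearly minimises the quadratic in \<open>t\<close>; the summand 1 in \<open>b\<close> covers \<open>h = 0\<close>.\<close>
    have "0 \<le> 2 * (- a / b) * a + (- a / b)\<^sup>2 * b"
      using *[of "- a / b"] by (rule order_trans) (simp add: b_def algebra_simps)
    also have "\<dots> = - (a\<^sup>2 / b)"
      using \<open>0 < b\<close> by (simp add: power2_eq_square field_simps)
    finally have "a = 0"
      using \<open>0 < b\<close> by (simp add: divide_le_0_iff)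
    then show ?thesis
      by (simp add: a_def)
  qed
  then show thesis
    by (rule that)
qed

lemma orth_proj_eqI:
  assumes diff: "\<And>x y. x \<in> M \<Longrightarrow> y \<in> M \<Longrightarrow> x - y \<in> M"
    and y: "y \<in> M" and orth: "\<And>h. h \<in> M \<Longrightarrow> ip x h = ip y h"
  shows "orth_proj ip M x = y"
  unfolding orth_proj_def
proof (rule the_equality)
  show "y \<in> M \<and> (\<forall>z\<in>M. ip (x - y) z = 0)"
    using y orth by (simp add: ip_diff_left)
next
  fix y' assume y': "y' \<in> M \<and> (\<forall>z\<in>M. ip (x - y') z = 0)"
  then have "y - y' \<in> M"
    using diff y by blast
  with y' orth have "ip (y - y') (y - y') = 0"
    by (simp add: ip_diff_left)
  then show "y' = y"
    by (simp add: ip_self)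
qed

text \<open>
  The Riesz representative of \<open>h \<mapsto> (\<Sum>j. \<langle>x j, E j h\<rangle>)\<close> interpolates, because on \<open>H k\<close> this
  functional reduces to the single term \<open>\<langle>x k, h\<rangle>\<close>.
\<close>

lemma ibap_if_separating:
  assumes diff: "\<And>k x y. x \<in> H k \<Longrightarrow> y \<in> H k \<Longrightarrow> x - y \<in> H k"
    and bl: "\<And>j. j \<in> {1..n} \<Longrightarrow> bounded_linear (E j)"
    and id: "\<And>j x. j \<in> {1..n} \<Longrightarrow> x \<in> H j \<Longrightarrow> E j x = x"
    and zero: "\<And>i j x. i \<in> {1..n} \<Longrightarrow> j \<in> {1..n} \<Longrightarrow> i \<noteq> j \<Longrightarrow> x \<in> H i \<Longrightarrow> E j x = 0"
  shows "ibap ip n H"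
  unfolding ibap_def
proof (intro allI impI)
  fix x assume x: "\<forall>k\<in>{1..n}. x k \<in> H k"
  have "bounded_linear (\<lambda>h. \<Sum>j\<in>{1..n}. ip (x j) (E j h))"
    by (intro bounded_linear_sum bounded_linear_compose[OF bounded_linear_ip] bl)
  then obtain z where z: "\<And>h. ip z h = (\<Sum>j\<in>{1..n}. ip (x j) (E j h))"
    using riesz_representation by blast
  have "orth_proj ip (H k) z = x k" if k: "k \<in> {1..n}" for k
  proof (rule orth_proj_eqI)
    fix h assume h: "h \<in> H k"
    have "ip (x j) (E j h) = (if j = k then ip (x k) h else 0)" if "j \<in> {1..n}" for j
      using id[OF k h] zero[OF k that _ h] bounded_linear.linear[OF bounded_linear_ip]
      by (auto simp: linear_0)
    then show "ip z h = ip (x k) h"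
      using k by (simp add: z)
  qed (use x k diff in auto)
  then show "\<exists>z. \<forall>k\<in>{1..n}. orth_proj ip (H k) z = x k"
    by blast
qed

end

section \<open>Operators separating generalised eigenspaces\<close>

text \<open>
  The base field acts by bounded maps that are linear over the reals, so that a single argument
  covers real and complex scalars.
\<close>

locale bounded_operator = vector_space scl
  for scl :: "'k::field \<Rightarrow> 'a::real_normed_vector \<Rightarrow> 'a" +
  fixes A :: "'a \<Rightarrow> 'a"
  assumes bounded_linear_scl: "bounded_linear (scl c)"
    and bounded_linear_A: "bounded_linear A"
    and A_scl: "A (scl c x) = scl c (A x)"
begin

text \<open>
  The operators built below are polynomials in \<open>A\<close>, but all that matters about them is that they
  lie in this algebra, whose members map every \<open>ker (A - \<lambda>)\<^sup>m\<close> into itself.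
\<close>

definition commutant :: "('a \<Rightarrow> 'a) set" where
  "commutant = {f. bounded_linear f \<and> (\<forall>x. f (A x) = A (f x)) \<and> (\<forall>c x. f (scl c x) = scl c (f x))}"

abbreviation shifted :: "'k \<Rightarrow> 'a \<Rightarrow> 'a" where
  "shifted c \<equiv> \<lambda>y. A y - scl c y"

lemma commutantD:
  assumes "f \<in> commutant"
  shows "bounded_linear f" and "f (A x) = A (f x)" and "f (scl c x) = scl c (f x)"
    and "f (x - y) = f x - f y" and "f 0 = 0"
  using assms by (simp_all add: commutant_def linear_simps)

lemma scl_in_commutant: "scl c \<in> commutant"
  by (simp add: commutant_def bounded_linear_scl A_scl mult.commute)

lemma A_in_commutant: "A \<in> commutant"
  by (simp add: commutant_def bounded_linear_A A_scl)

lemma ident_in_commutant: "(\<lambda>x. x) \<in> commutant"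
  by (simp add: commutant_def bounded_linear_ident)

lemma comp_in_commutant: "f \<in> commutant \<Longrightarrow> g \<in> commutant \<Longrightarrow> (\<lambda>x. f (g x)) \<in> commutant"
  by (simp add: commutant_def bounded_linear_compose)

lemma diff_in_commutant: "f \<in> commutant \<Longrightarrow> g \<in> commutant \<Longrightarrow> (\<lambda>x. f x - g x) \<in> commutant"
  using commutantD(4)[OF A_in_commutant]
  by (simp add: commutant_def bounded_linear_sub scale_right_diff_distrib)

lemma funpow_in_commutant: "f \<in> commutant \<Longrightarrow> f ^^ k \<in> commutant"
proof (induction k)
  case 0
  then show ?case using ident_in_commutant by (simp add: id_def)
next
  case (Suc k)
  then show ?case using comp_in_commutant[of f "f ^^ k"] by (simp add: comp_def)
qed

lemma shifted_in_commutant: "shifted c \<in> commutant"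
  by (intro diff_in_commutant A_in_commutant scl_in_commutant)

lemma ker_power_diff:
  "x \<in> ker_power scl A c p \<Longrightarrow> y \<in> ker_power scl A c p \<Longrightarrow> x - y \<in> ker_power scl A c p"
  by (simp add: ker_power_def commutantD(4)[OF funpow_in_commutant[OF shifted_in_commutant]])

lemma commutant_preserves_ker_power:
  assumes f: "f \<in> commutant" and x: "x \<in> ker_power scl A c p"
  shows "f x \<in> ker_power scl A c p"
proof -
  have "(shifted c ^^ p) (f x) = f ((shifted c ^^ p) x)"
    by (induction p) (simp_all add: commutantD[OF f])
  then show ?thesis
    using x by (simp add: ker_power_def commutantD(5)[OF f])
qed

text \<open>
  The operator is \<open>1 - (1 - T\<^sup>q)\<^sup>p\<close> with \<open>T = (A - b) / (a - b)\<close>. Each factor \<open>1 - T\<^sup>q\<close> is a multiple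
  of \<open>A - a\<close> and so lowers the order of a generalised eigenvector for \<open>a\<close>; on the other kernel
  \<open>T\<^sup>q\<close> vanishes.
\<close>

lemma separate_two_kernels:
  assumes "a \<noteq> b"
  obtains G where "G \<in> commutant"
    and "\<And>x. x \<in> ker_power scl A a p \<Longrightarrow> G x = x"
    and "\<And>x. x \<in> ker_power scl A b q \<Longrightarrow> G x = 0"
proof -
  define r where "r = inverse (a - b)"
  define T where "T = (\<lambda>x. scl r (shifted b x))"
  define S where "S = (\<lambda>x. x - (T ^^ q) x)"
  define G where "G = (\<lambda>x. x - (S ^^ p) x)"
  have T: "T \<in> commutant"
    unfolding T_def by (rule comp_in_commutant[OF scl_in_commutant shifted_in_commutant])
  have S: "S \<in> commutant"
    unfolding S_def by (intro diff_in_commutant ident_in_commutant funpow_in_commutant T)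
  have G: "G \<in> commutant"
    unfolding G_def by (intro diff_in_commutant ident_in_commutant funpow_in_commutant S)
  have "r * (a - b) = 1"
    using assms by (simp add: r_def)
  then have ident_eq: "scl r (scl a x) - scl r (scl b x) = x" for x
    by (simp flip: scale_left_diff_distrib right_diff_distrib)
  have ident_minus_T: "x - T x = scl (- r) (shifted a x)" for x
    using ident_eq[of x] unfolding T_def by (simp add: scale_right_diff_distrib algebra_simps)
  have T_lowers: "x - T x \<in> ker_power scl A a k" if "x \<in> ker_power scl A a (Suc k)" for x k
  proof -
    have "shifted a x \<in> ker_power scl A a k"
      using that by (simp add: ker_power_def funpow_Suc_right del: funpow.simps)
    then show ?thesis
      unfolding ident_minus_T by (rule commutant_preserves_ker_power[OF scl_in_commutant])
  qed
  have S_lowers: "S x \<in> ker_power scl A a k" if x: "x \<in> ker_power scl A a (Suc k)" for x k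
    unfolding S_def
  proof (induction q)
    case 0
    then show ?case using ker_power_diff[of 0 _ k 0]
      by (simp add: ker_power_def commutantD(5)[OF funpow_in_commutant[OF shifted_in_commutant]])
  next
    case (Suc i)
    have "(T ^^ i) x - T ((T ^^ i) x) \<in> ker_power scl A a k"
      by (intro T_lowers commutant_preserves_ker_power[OF funpow_in_commutant[OF T]] x)
    moreover have "x - (T ^^ Suc i) x = (x - (T ^^ i) x) - (T ((T ^^ i) x) - (T ^^ i) x)"
      by simp
    moreover have "T ((T ^^ i) x) - (T ^^ i) x \<in> ker_power scl A a k"
      using commutant_preserves_ker_power[OF scl_in_commutant[of "-1"] calculation(1)] by simp
    ultimately show ?case
      using ker_power_diff Suc.IH by metis
  qed
  have S_power: "x \<in> ker_power scl A a k \<Longrightarrow> (S ^^ k) x = 0" for x k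
  proof (induction k arbitrary: x)
    case 0
    then show ?case by (simp add: ker_power_def)
  next
    case (Suc k)
    then show ?case
      using S_lowers by (simp add: funpow_swap1)
  qed
  have T_power: "(T ^^ k) x = scl (r ^ k) ((shifted b ^^ k) x)" for x k
  proof (induction k)
    case (Suc k)
    then show ?case
      by (simp add: T_def A_scl scale_right_diff_distrib mult.commute mult.left_commute)
  qed simp
  have "(S ^^ k) x = x" if "x \<in> ker_power scl A b q" for x k
  proof (induction k)
    case (Suc k)
    then show ?case
      using that by (simp add: S_def T_power ker_power_def)
  qed simp
  then show thesis
    using that[OF G] S_power by (simp add: G_def)
qed

text \<open>
  Composing the operators of \<open>separate_two_kernels\<close> keeps what each of them achieves, because
  all of them preserve every kernel.
\<close>

lemma separate_kernels:
  assumes "finite I" and "\<And>i. i \<in> I \<Longrightarrow> l i \<noteq> a"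
  obtains E where "E \<in> commutant"
    and "\<And>x. x \<in> ker_power scl A a p \<Longrightarrow> E x = x"
    and "\<And>i x. i \<in> I \<Longrightarrow> x \<in> ker_power scl A (l i) (m i) \<Longrightarrow> E x = 0"
  using assms
proof (induction I arbitrary: thesis rule: finite_induct)
  case empty
  then show ?case using ident_in_commutant by blast
next
  case (insert i I)
  obtain E where E: "E \<in> commutant" "\<And>x. x \<in> ker_power scl A a p \<Longrightarrow> E x = x"
    "\<And>i x. i \<in> I \<Longrightarrow> x \<in> ker_power scl A (l i) (m i) \<Longrightarrow> E x = 0"
    using insert.IH insert.prems(2) by blast
  obtain G where G: "G \<in> commutant" "\<And>x. x \<in> ker_power scl A a p \<Longrightarrow> G x = x"
    "\<And>x. x \<in> ker_power scl A (l i) (m i) \<Longrightarrow> G x = 0"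
    using separate_two_kernels[of a "l i"] insert.prems(2) by (metis insertI1)
  show ?case
  proof (rule insert.prems(1))
    show "(\<lambda>x. E (G x)) \<in> commutant"
      using E(1) G(1) by (rule comp_in_commutant)
    show "E (G x) = x" if "x \<in> ker_power scl A a p" for x
      using that E(2) G(2) by simp
    show "E (G x) = 0" if "j \<in> insert i I" "x \<in> ker_power scl A (l j) (m j)" for j x
      using that E(3) G(3) commutantD(5)[OF E(1)] commutant_preserves_ker_power[OF G(1)]
      by (metis insertE)
  qed
qed

end

lemma ibap_ker_power:
  assumes "real_form ip" and "bounded_operator scl A" and "inj_on l {1..n}"
  shows "ibap ip n (\<lambda>k. ker_power scl A (l k) (m k))"
proof -
  interpret real_form ip by fact
  interpret bounded_operator scl A by fact
  have "\<exists>E. E \<in> commutant \<and> (\<forall>x\<in>ker_power scl A (l j) (m j). E x = x) \<and>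
      (\<forall>i\<in>{1..n} - {j}. \<forall>x\<in>ker_power scl A (l i) (m i). E x = 0)" if "j \<in> {1..n}" for j
  proof (rule separate_kernels[of "{1..n} - {j}" l "l j" "m j" m])
    show "l i \<noteq> l j" if "i \<in> {1..n} - {j}" for i
      using that \<open>j \<in> {1..n}\<close> assms(3) by (auto dest: inj_onD)
  qed blast+
  then obtain E where E: "\<And>j. j \<in> {1..n} \<Longrightarrow> E j \<in> commutant"
    "\<And>j x. j \<in> {1..n} \<Longrightarrow> x \<in> ker_power scl A (l j) (m j) \<Longrightarrow> E j x = x"
    "\<And>i j x. j \<in> {1..n} \<Longrightarrow> i \<in> {1..n} - {j} \<Longrightarrow> x \<in> ker_power scl A (l i) (m i) \<Longrightarrow> E j x = 0"
    by metis
  show ?thesis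
    by (rule ibap_if_separating[where E = E])
      (use E in \<open>auto intro: ker_power_diff commutantD(1)\<close>)
qed

section \<open>The two base fields\<close>

lemma linear_continuous_imp_bounded_linear:
  fixes f :: "'a::real_normed_vector \<Rightarrow> 'b::real_normed_vector"
  assumes "linear f" and "continuous_on UNIV f"
  shows "bounded_linear f"
proof -
  interpret linear f by fact
  have "isCont f 0"
    using assms(2) by (simp add: continuous_on_eq_continuous_at)
  then obtain e where e: "0 < e" "\<And>x. norm x < e \<Longrightarrow> norm (f x) < 1"
    unfolding continuous_at_eps_delta by (metis dist_0_norm dist_commute zero zero_less_one)
  show ?thesis
  proof (rule bounded_linear_intro[where K = "2 / e"])
    fix x
    show "norm (f x) \<le> norm x * (2 / e)"
    proof (cases "x = 0")
      case False
      define s where "s = e / (2 * norm x)"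
      have "0 < s" and "norm (s *\<^sub>R x) < e"
        using False e(1) by (simp_all add: s_def)
      then have "s * norm (f x) < 1"
        using e(2)[of "s *\<^sub>R x"] by (simp add: scale)
      then show ?thesis
        using False e(1) by (simp add: s_def field_simps)
    qed (simp add: zero)
  qed (simp_all add: add scale)
qed

lemma real_form_inner: "real_form (inner :: 'a::{real_inner, complete_space} \<Rightarrow> _)"
  by unfold_locales (simp_all add: inner_commute inner_add_left inner_add_right power2_norm_eq_inner)

lemma real_form_Re_cinner: "real_form (\<lambda>x y :: 'a::complex_hilbert. Re (cinner x y))"
proof
  fix x y z :: 'a and r :: real
  show "Re (cinner x y) = Re (cinner y x)"
    by (metis cinner_commute cnj.sel(1))
  show "Re (cinner (r *\<^sub>R x) y) = r * Re (cinner x y)"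
    by (simp add: scaleR_scaleC cinner_scaleC_left)
qed (simp_all add: cinner_add_left norm_eq_sqrt_cinner cinner_ge_zero)

lemma norm_scaleC: "norm (c *\<^sub>C x) = cmod c * norm (x :: 'a::complex_inner)"
proof -
  have "cinner (c *\<^sub>C x) (c *\<^sub>C x) = c * cnj (c * cinner x x)"
    by (metis cinner_commute cinner_scaleC_left)
  also have "\<dots> = (c * cnj c) * cinner x x"
    by (metis cinner_commute complex_cnj_mult mult.assoc)
  also have "\<dots> = of_real ((cmod c)\<^sup>2) * cinner x x"
    by (simp add: complex_norm_square del: of_real_power)
  finally show ?thesis
    by (simp add: norm_eq_sqrt_cinner[of x] norm_eq_sqrt_cinner[of "c *\<^sub>C x"] real_sqrt_mult)
qed

text \<open>
  If \<open>M\<close> is invariant under \<open>\<i>\<close>, then orthogonality to \<open>M\<close> for the real part already gives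
  orthogonality, since \<open>Im \<langle>u, v\<rangle> = Re \<langle>u, \<i> v\<rangle>\<close>.
\<close>

lemma orth_proj_Re_cinner:
  assumes "\<And>x. x \<in> M \<Longrightarrow> \<i> *\<^sub>C x \<in> M"
  shows "orth_proj cinner M x = orth_proj (\<lambda>x y. Re (cinner x y)) M x"
proof -
  have Re_i: "Re (cinner u (\<i> *\<^sub>C v)) = Im (cinner u v)" for u v :: 'a
  proof -
    have "cinner u (\<i> *\<^sub>C v) = cnj \<i> * cinner u v"
      by (metis cinner_commute cinner_scaleC_left complex_cnj_mult)
    then show ?thesis by simp
  qed
  have "(\<forall>z\<in>M. cinner u z = 0) \<longleftrightarrow> (\<forall>z\<in>M. Re (cinner u z) = 0)" for u
    using assms by (auto simp: complex_eq_iff simp flip: Re_i)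
  then show ?thesis
    by (simp add: orth_proj_def)
qed

lemma bounded_operator_real:
  assumes "linear A" and "continuous_on UNIV A"
  shows "bounded_operator scaleR A"
proof (intro bounded_operator.intro bounded_operator_axioms.intro real_vector.vector_space_axioms)
  show "bounded_linear A"
    using assms by (rule linear_continuous_imp_bounded_linear)
qed (simp_all add: bounded_linear_scaleR_right linear_cmul[OF assms(1)] algebra_simps)

lemma bounded_operator_complex:
  fixes B :: "'a::complex_inner \<Rightarrow> 'a"
  assumes "Vector_Spaces.linear scaleC scaleC B" and "continuous_on UNIV B"
  shows "bounded_operator scaleC B"
proof -
  interpret B: Vector_Spaces.linear "scaleC :: complex \<Rightarrow> 'a \<Rightarrow> 'a" scaleC B by fact
  have "linear B"
    by (rule linearI) (simp_all add: B.add B.scale scaleR_scaleC)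
  show ?thesis
  proof (intro bounded_operator.intro bounded_operator_axioms.intro vector_space_scaleC)
    show "bounded_linear B"
      using \<open>linear B\<close> assms(2) by (rule linear_continuous_imp_bounded_linear)
    show "bounded_linear (scaleC c :: 'a \<Rightarrow> 'a)" for c
      by (rule bounded_linear_intro[where K = "cmod c"])
        (simp_all add: scaleC_add_right scaleR_scaleC scaleC_scaleC norm_scaleC mult.commute)
  qed (rule B.scale)
qed

theorem theorem4p3:
  fixes n :: nat and m :: "nat \<Rightarrow> nat"
    and A :: "'a::{real_inner, complete_space} \<Rightarrow> 'a" and l :: "nat \<Rightarrow> real"
    and B :: "'b::complex_hilbert \<Rightarrow> 'b" and \<mu> :: "nat \<Rightarrow> complex"
  assumes "1 \<le> n" and "\<forall>k\<in>{1..n}. 1 \<le> m k"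
  shows "(linear A \<and> continuous_on UNIV A \<and> inj_on l {1..n} \<longrightarrow>
            ibap inner n (\<lambda>k. ker_power scaleR A (l k) (m k))) \<and>
         (Vector_Spaces.linear scaleC scaleC B \<and> continuous_on UNIV B \<and> inj_on \<mu> {1..n} \<longrightarrow>
            ibap cinner n (\<lambda>k. ker_power scaleC B (\<mu> k) (m k)))"
proof (intro conjI impI)
  assume "linear A \<and> continuous_on UNIV A \<and> inj_on l {1..n}"
  then show "ibap inner n (\<lambda>k. ker_power scaleR A (l k) (m k))"
    by (intro ibap_ker_power real_form_inner bounded_operator_real) auto
next
  assume B: "Vector_Spaces.linear scaleC scaleC B \<and> continuous_on UNIV B \<and> inj_on \<mu> {1..n}"
  then interpret bounded_operator scaleC B
    by (intro bounded_operator_complex) auto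
  have "ibap (\<lambda>x y. Re (cinner x y)) n (\<lambda>k. ker_power scaleC B (\<mu> k) (m k))"
    using B by (intro ibap_ker_power real_form_Re_cinner bounded_operator_axioms) auto
  then show "ibap cinner n (\<lambda>k. ker_power scaleC B (\<mu> k) (m k))"
    unfolding ibap_def
    by (simp add: orth_proj_Re_cinner commutant_preserves_ker_power[OF scl_in_commutant])
qed

end
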